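(* For any immersed surface $\Sigma$ in $S^3=SU(2)$ with conformal parameter $z$ and immersion $f$, let $\psi=(\psi_1,\psi_2)^\top$ be the spinor field defined by $$df=f\cdot(\Psi\,dz+\Psi^*d\bar z),\qquad \Psi=\sum_{j=1}^3Z_je_j,\quad \Psi^*=\sum_{j=1}^3\bar Z_je_j,$$ $$Z_1=\frac i2(\bar\psi_2^2+\psi_1^2),\qquad Z_2=\frac12(\bar\psi_2^2-\psi_1^2),\qquad Z_3=\psi_1\bar\psi_2 .$$ Then $\psi$ satisfies the Dirac equation $\mathcal{D}^S\psi=0$ with $$\mathcal{D}^S=\begin{pmatrix}0&\partial\\-\bar\partial&0\end{pmatrix}+\begin{pmatrix}V&0\\0&\bar V\end{pmatrix},\qquad V=\frac12(H-i)(|\psi_1|^2+|\psi_2|^2),$$ where $H$ is the mean curvature of $\Sigma$.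
   Context: $z=x+iy$, $\partial=\frac12(\partial_x-i\partial_y)$, $\bar\partial=\frac12(\partial_x+i\partial_y)$. $S^3$ is identified with $SU(2)$ with the biinvariant metric given on $su(2)$ by $\langle\xi,\eta\rangle=-\frac12\mathrm{Tr}(\xi\eta)$, for which $$e_1=\begin{pmatrix}i&0\\0&-i\end{pmatrix},\quad e_2=\begin{pmatrix}0&1\\-1&0\end{pmatrix},\quad e_3=\begin{pmatrix}0&i\\i&0\end{pmatrix}$$ is an orthonormal basis with $[e_j,e_k]=2\varepsilon_{jkl}e_l$; $SU(2)$ is then isometric to the unit sphere in $\mathbb{R}^4$. The dot $f\cdot$ denotes left translation by $f$. The induced metric is $e^{2\alpha}dzd\bar z$; conformality of $z$ gives $Z_1^2+Z_2^2+Z_3^2=0$ and $|Z_1|^2+|Z_2|^2+|Z_3|^2=\frac12e^{2\alpha}$, so that $\psi$ is defined up to a common sign and $e^\alpha=|\psi_1|^2+|\psi_2|^2$. The unit normal is $N$ with $f^{-1}\cdot N=-ie^{-2\alpha}[f^{-1}\cdot\partial f,f^{-1}\cdot\bar\partial f]$, and the mean curvature $H$ is defined by: the tension field of $f$ (with respect to the induced metric) equals $2HN$. *)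

theory Defs
  imports "HOL-Analysis.Analysis"
begin

section \<open>The group \<open>SU(2)\<close> with its biinvariant metric\<close>

definition cscale :: "complex \<Rightarrow> complex^'n^'m \<Rightarrow> complex^'n^'m" where
  "cscale c A = map_matrix ((*) c) A"

definition SU2 :: "(complex^2^2) set" where
  "SU2 = {A. map_matrix cnj (transpose A) ** A = mat 1 \<and> det A = 1}"

definition su2 :: "(complex^2^2) set" where
  "su2 = {A. map_matrix cnj (transpose A) = - A \<and> trace A = 0}"

definition commutator :: "complex^2^2 \<Rightarrow> complex^2^2 \<Rightarrow> complex^2^2" where
  "commutator A B = A ** B - B ** A"

definition su2_basis :: "complex^2^2^3" where
  "su2_basis = vector
     [vector [vector [\<i>, 0], vector [0, - \<i>]],
      vector [vector [0, 1], vector [- 1, 0]],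
      vector [vector [0, \<i>], vector [\<i>, 0]]]"

text \<open>On \<open>su2\<close> the trace of a product is real, so taking the real part only fixes the type.\<close>

definition su2_inner :: "complex^2^2 \<Rightarrow> complex^2^2 \<Rightarrow> real" where
  "su2_inner \<xi> \<eta> = - (1/2) * Re (trace (\<xi> ** \<eta>))"

definition SU2_metric :: "complex^2^2 \<Rightarrow> complex^2^2 \<Rightarrow> complex^2^2 \<Rightarrow> real" where
  "SU2_metric g X Y = su2_inner (matrix_inv g ** X) (matrix_inv g ** Y)"

text \<open>The Levi-Civita connection of the biinvariant metric on left-invariant fields; the lemmas
  below show that it is torsion free and metric, which characterises it.\<close>

definition su2_nabla :: "complex^2^2 \<Rightarrow> complex^2^2 \<Rightarrow> complex^2^2" where
  "su2_nabla \<xi> \<eta> = (1/2) *\<^sub>R commutator \<xi> \<eta>"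

lemma su2_nabla_torsion_free: "su2_nabla \<xi> \<eta> - su2_nabla \<eta> \<xi> = commutator \<xi> \<eta>"
proof -
  have "commutator \<eta> \<xi> = - commutator \<xi> \<eta>"
    by (simp add: commutator_def)
  then show ?thesis
    by (simp add: su2_nabla_def flip: scaleR_left_distrib)
qed

lemma su2_nabla_metric: "su2_inner (su2_nabla \<xi> \<eta>) \<zeta> + su2_inner \<eta> (su2_nabla \<xi> \<zeta>) = 0"
proof -
  have scale: "trace (r *\<^sub>R A) = r *\<^sub>R trace A" for r and A :: "complex^2^2"
    by (simp add: trace_def scaleR_sum_right)
  have assoc: "(r *\<^sub>R A) ** B = r *\<^sub>R (A ** B)" "A ** (r *\<^sub>R B) = r *\<^sub>R (A ** B)"
    for r and A B :: "complex^2^2"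
    by (simp_all add: matrix_matrix_mult_def vec_eq_iff scaleR_sum_right)
  have diff: "A ** (B - C) = A ** B - A ** C" "(A - B) ** C = A ** C - B ** C"
    for A B C :: "complex^2^2"
    by (simp_all add: matrix_matrix_mult_def vec_eq_iff sum_subtractf algebra_simps)
  have "trace (\<eta> ** (\<zeta> ** \<xi>)) = trace ((\<xi> ** \<eta>) ** \<zeta>)"
    by (metis matrix_mul_assoc trace_mul_sym)
  then show ?thesis
    by (simp add: su2_nabla_def su2_inner_def commutator_def scale assoc trace_sub
        diff matrix_mul_assoc field_simps)
qed

lemma su2_basis_in_su2: "su2_basis $ j \<in> su2"
proof -
  have "\<forall>j. su2_basis $ j \<in> su2"
    by (simp add: forall_3 su2_basis_def su2_def vec_eq_iff forall_2 transpose_def trace_def sum_2)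
  then show ?thesis ..
qed

lemma su2_basis_orthonormal:
  "su2_inner (su2_basis $ j) (su2_basis $ k) = (if j = k then 1 else 0)"
proof -
  have "\<forall>j k. su2_inner (su2_basis $ j) (su2_basis $ k) = (if j = k then 1 else 0)"
    by (simp add: forall_3 su2_basis_def su2_inner_def trace_def matrix_matrix_mult_def sum_2)
  then show ?thesis by blast
qed

lemma su2_basis_commutator:
  "commutator (su2_basis $ 1) (su2_basis $ 2) = 2 *\<^sub>R su2_basis $ 3"
  "commutator (su2_basis $ 2) (su2_basis $ 3) = 2 *\<^sub>R su2_basis $ 1"
  "commutator (su2_basis $ 3) (su2_basis $ 1) = 2 *\<^sub>R su2_basis $ 2"
  by (simp_all add: su2_basis_def commutator_def matrix_matrix_mult_def vec_eq_iff forall_2 sum_2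
      complex_eq_iff)

section \<open>Partial derivatives in the parameter \<open>z = x + i y\<close>\<close>

text \<open>The index type \<open>2\<close> labels the real coordinates: \<open>1\<close> stands for \<open>x\<close> and \<open>2\<close> for \<open>y\<close>.\<close>

definition coord_dir :: "2 \<Rightarrow> complex" where
  "coord_dir i = (if i = 1 then 1 else \<i>)"

definition pd :: "2 \<Rightarrow> (complex \<Rightarrow> 'b::real_normed_vector) \<Rightarrow> complex \<Rightarrow> 'b" where
  "pd i f z = frechet_derivative f (at z) (coord_dir i)"

definition del :: "(complex \<Rightarrow> complex) \<Rightarrow> complex \<Rightarrow> complex" where
  "del g z = (1/2) * (pd 1 g z - \<i> * pd 2 g z)"

definition delbar :: "(complex \<Rightarrow> complex) \<Rightarrow> complex \<Rightarrow> complex" where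
  "delbar g z = (1/2) * (pd 1 g z + \<i> * pd 2 g z)"

definition mat_del :: "(complex \<Rightarrow> complex^2^2) \<Rightarrow> complex \<Rightarrow> complex^2^2" where
  "mat_del f z = (\<chi> i j. del (\<lambda>w. f w $ i $ j) z)"

definition mat_delbar :: "(complex \<Rightarrow> complex^2^2) \<Rightarrow> complex \<Rightarrow> complex^2^2" where
  "mat_delbar f z = (\<chi> i j. delbar (\<lambda>w. f w $ i $ j) z)"

primrec Ck_on :: "nat \<Rightarrow> complex set \<Rightarrow> (complex \<Rightarrow> 'b::real_normed_vector) \<Rightarrow> bool" where
  "Ck_on 0 U f \<longleftrightarrow> continuous_on U f"
| "Ck_on (Suc k) U f \<longleftrightarrow> (\<forall>z\<in>U. f differentiable (at z)) \<and> (\<forall>i. Ck_on k U (pd i f))"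

section \<open>Immersed surfaces in \<open>SU(2)\<close>\<close>

text \<open>\<open>C\<^sup>2\<close> is the least regularity for which the tension field makes sense.\<close>

definition immersion_on :: "complex set \<Rightarrow> (complex \<Rightarrow> complex^2^2) \<Rightarrow> bool" where
  "immersion_on U f \<longleftrightarrow> Ck_on 2 U f \<and> f ` U \<subseteq> SU2 \<and>
     (\<forall>z\<in>U. inj (frechet_derivative f (at z)))"

definition induced_metric :: "(complex \<Rightarrow> complex^2^2) \<Rightarrow> complex \<Rightarrow> complex \<Rightarrow> complex \<Rightarrow> real" where
  "induced_metric f z v w =
     SU2_metric (f z) (frechet_derivative f (at z) v) (frechet_derivative f (at z) w)"

text \<open>The induced metric is \<open>e\<^sup>2\<^sup>\<alpha> dz d\<zeta>\<close> with \<open>\<zeta>\<close> the conjugate of \<open>z\<close>,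
  that is, \<open>e\<^sup>2\<^sup>\<alpha> (dx\<^sup>2 + dy\<^sup>2)\<close>.\<close>

definition conformal_parameter ::
    "complex set \<Rightarrow> (complex \<Rightarrow> complex^2^2) \<Rightarrow> (complex \<Rightarrow> real) \<Rightarrow> bool" where
  "conformal_parameter U f \<alpha> \<longleftrightarrow>
     (\<forall>z\<in>U. \<forall>v w. induced_metric f z v w = exp (2 * \<alpha> z) * Re (v * cnj w))"

definition metric_coeff :: "(complex \<Rightarrow> complex^2^2) \<Rightarrow> complex \<Rightarrow> real^2^2" where
  "metric_coeff f z = (\<chi> i j. induced_metric f z (coord_dir i) (coord_dir j))"

text \<open>\<open>christoffel f z k i j\<close> is the symbol with upper index \<open>k\<close> of the induced metric.\<close>

definition christoffel :: "(complex \<Rightarrow> complex^2^2) \<Rightarrow> complex \<Rightarrow> 2 \<Rightarrow> 2 \<Rightarrow> 2 \<Rightarrow> real" where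
  "christoffel f z k i j = (1/2) * (\<Sum>l\<in>UNIV. matrix_inv (metric_coeff f z) $ k $ l *
     (pd i (\<lambda>w. metric_coeff f w $ j $ l) z + pd j (\<lambda>w. metric_coeff f w $ i $ l) z
       - pd l (\<lambda>w. metric_coeff f w $ i $ j) z))"

text \<open>Covariant derivative along \<open>f\<close> of a field \<open>X\<close> with \<open>X w\<close> tangent to \<open>SU(2)\<close> at \<open>f w\<close>:
  in the left trivialisation \<open>X = f \<cdot> \<eta>\<close> it is \<open>f \<cdot> (\<partial>\<^sub>i \<eta> + \<nabla>\<^sub>\<xi> \<eta>)\<close>
  with \<open>\<xi>\<close> the left translate of \<open>\<partial>\<^sub>i f\<close> to the identity.\<close>

definition cov_deriv ::
    "(complex \<Rightarrow> complex^2^2) \<Rightarrow> 2 \<Rightarrow> (complex \<Rightarrow> complex^2^2) \<Rightarrow> complex \<Rightarrow> complex^2^2" where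
  "cov_deriv f i X z = f z ** (pd i (\<lambda>w. matrix_inv (f w) ** X w) z
     + su2_nabla (matrix_inv (f z) ** pd i f z) (matrix_inv (f z) ** X z))"

text \<open>The tension field is the trace of \<open>\<nabla>df\<close> with respect to the induced metric.\<close>

definition second_fund :: "(complex \<Rightarrow> complex^2^2) \<Rightarrow> complex \<Rightarrow> 2 \<Rightarrow> 2 \<Rightarrow> complex^2^2" where
  "second_fund f z i j =
     cov_deriv f i (pd j f) z - (\<Sum>k\<in>UNIV. christoffel f z k i j *\<^sub>R pd k f z)"

definition tension :: "(complex \<Rightarrow> complex^2^2) \<Rightarrow> complex \<Rightarrow> complex^2^2" where
  "tension f z =
     (\<Sum>i\<in>UNIV. \<Sum>j\<in>UNIV. matrix_inv (metric_coeff f z) $ i $ j *\<^sub>R second_fund f z i j)"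

definition unit_normal :: "(complex \<Rightarrow> real) \<Rightarrow> (complex \<Rightarrow> complex^2^2) \<Rightarrow> complex \<Rightarrow> complex^2^2" where
  "unit_normal \<alpha> f z = f z ** cscale (- \<i> * of_real (exp (- 2 * \<alpha> z)))
     (commutator (matrix_inv (f z) ** mat_del f z) (matrix_inv (f z) ** mat_delbar f z))"

definition mean_curvature :: "(complex \<Rightarrow> real) \<Rightarrow> (complex \<Rightarrow> complex^2^2) \<Rightarrow> complex \<Rightarrow> real" where
  "mean_curvature \<alpha> f z = (THE H. tension f z = (2 * H) *\<^sub>R unit_normal \<alpha> f z)"

section \<open>Spinor field and Dirac operator\<close>

definition spinor_Z :: "complex^2 \<Rightarrow> complex^3" where
  "spinor_Z p = vector
     [\<i> / 2 * ((cnj (p $ 2))\<^sup>2 + (p $ 1)\<^sup>2),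
      1 / 2 * ((cnj (p $ 2))\<^sup>2 - (p $ 1)\<^sup>2),
      p $ 1 * cnj (p $ 2)]"

definition Psi :: "complex^2 \<Rightarrow> complex^2^2" where
  "Psi p = (\<Sum>j\<in>UNIV. cscale (spinor_Z p $ j) (su2_basis $ j))"

definition Psi_star :: "complex^2 \<Rightarrow> complex^2^2" where
  "Psi_star p = (\<Sum>j\<in>UNIV. cscale (cnj (spinor_Z p $ j)) (su2_basis $ j))"

text \<open>\<open>df = f \<cdot> (\<Psi> dz + \<Psi>\<^sup>* d\<zeta>)\<close> evaluated on a tangent vector \<open>v\<close>, where \<open>dz v = v\<close>
  and \<open>d\<zeta> v = cnj v\<close>.  These equations determine \<open>\<psi>\<close> pointwise up to sign; continuity
  excludes arbitrary jumps between the two choices.\<close>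

definition spinor_field ::
    "complex set \<Rightarrow> (complex \<Rightarrow> complex^2^2) \<Rightarrow> (complex \<Rightarrow> complex^2) \<Rightarrow> bool" where
  "spinor_field U f \<psi> \<longleftrightarrow> continuous_on U \<psi> \<and>
     (\<forall>z\<in>U. (f has_derivative
        (\<lambda>v. f z ** (cscale v (Psi (\<psi> z)) + cscale (cnj v) (Psi_star (\<psi> z))))) (at z))"

definition dirac_op :: "(complex \<Rightarrow> complex) \<Rightarrow> (complex \<Rightarrow> complex^2) \<Rightarrow> complex \<Rightarrow> complex^2" where
  "dirac_op V \<psi> z =
     vector [del (\<lambda>w. \<psi> w $ 2) z, - delbar (\<lambda>w. \<psi> w $ 1) z]
     + (vector [vector [V z, 0], vector [0, cnj (V z)]] :: complex^2^2) *v \<psi> z"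

definition potential :: "(complex \<Rightarrow> real) \<Rightarrow> (complex \<Rightarrow> complex^2) \<Rightarrow> complex \<Rightarrow> complex" where
  "potential H \<psi> z =
     1/2 * (of_real (H z) - \<i>) * of_real ((cmod (\<psi> z $ 1))\<^sup>2 + (cmod (\<psi> z $ 2))\<^sup>2)"

end

theory Submission
  imports Defs
begin

text \<open>Write \<open>\<Psi> = f\<^sup>-\<^sup>1 \<cdot> \<partial>f\<close>, \<open>a = \<psi>\<^sub>1\<close>, \<open>b = \<psi>\<^sub>2\<close>, \<open>r = |a|\<^sup>2 + |b|\<^sup>2\<close>,
  \<open>p = delbar a\<close> and \<open>q = delbar (cnj b)\<close>. The entries of \<open>\<Psi>\<close> determine \<open>a\<^sup>2\<close>,
  \<open>(cnj b)\<^sup>2\<close> and \<open>a (cnj b)\<close>; as \<open>\<psi>\<close> is continuous without zeros, it inherits the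
  differentiability of \<open>\<Psi>\<close>. Symmetry of the second derivatives of \<open>f\<close> gives the
  Maurer-Cartan equation \<open>delbar \<Psi> - del \<Psi>\<^sup>* = [\<Psi>, \<Psi>\<^sup>*] = \<i> r W\<close>, where \<open>W / r\<close> is the
  unit normal moved to the identity. These equations force \<open>p = x b\<close>, \<open>q = - x (cnj a)\<close> with
  \<open>Im x = r / 2\<close>, so that \<open>delbar \<Psi> = x W\<close>. In a conformal parameter the tension field is
  \<open>2 r\<^sup>-\<^sup>2 f \<cdot> (delbar \<Psi> + del \<Psi>\<^sup>*) = 4 r\<^sup>-\<^sup>2 (Re x) f \<cdot> W\<close>, whence \<open>Re x = r H / 2\<close> and
  \<open>x = cnj V\<close>.\<close>

section \<open>Symmetry of second derivatives and differentiability of square roots\<close>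

text \<open>Two uses of the mean value theorem: first along \<open>u\<close>, for the increment of
  \<open>g\<close> in direction \<open>v\<close>, then along \<open>v\<close>, for the derivative of
  \<open>g\<close> in direction \<open>u\<close>.\<close>

lemma second_difference_mvt:
  fixes g :: "'a::real_normed_vector \<Rightarrow> real"
  assumes g: "\<And>w. w \<in> ball z d \<Longrightarrow> (g has_derivative G w) (at w)"
    and G: "\<And>w. w \<in> ball z d \<Longrightarrow> ((\<lambda>w. G w u) has_derivative K w) (at w)"
    and h: "0 < h" "h * (norm u + norm v) < d"
  shows "\<exists>\<xi>\<in>ball z d. g (z + h *\<^sub>R u + h *\<^sub>R v) - g (z + h *\<^sub>R u) - g (z + h *\<^sub>R v) + g z
            = h * h * K \<xi> v"
proof -
  have inball: "z + s *\<^sub>R u + t *\<^sub>R v \<in> ball z d" if "0 \<le> s" "s \<le> h" "0 \<le> t" "t \<le> h" for s t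
  proof -
    have "norm (s *\<^sub>R u + t *\<^sub>R v) \<le> s * norm u + t * norm v"
      using norm_triangle_ineq[of "s *\<^sub>R u" "t *\<^sub>R v"] that by simp
    also have "\<dots> \<le> h * norm u + h * norm v"
      using that by (intro add_mono mult_right_mono) auto
    also have "\<dots> < d" using h(2) by (simp add: algebra_simps)
    finally have "norm (s *\<^sub>R u + t *\<^sub>R v) < d" .
    moreover have "dist z (z + s *\<^sub>R u + t *\<^sub>R v) = norm (s *\<^sub>R u + t *\<^sub>R v)"
      using norm_minus_cancel[of "s *\<^sub>R u + t *\<^sub>R v"] by (simp add: dist_norm)
    ultimately show ?thesis by simp
  qed
  have der: "((\<lambda>s. g (z + s *\<^sub>R u + t *\<^sub>R v)) has_derivative
      (\<lambda>c. c * G (z + s *\<^sub>R u + t *\<^sub>R v) u)) (at s within {0..h})"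
    if "0 \<le> s" "s \<le> h" "0 \<le> t" "t \<le> h" for s t
  proof -
    note gd = g[OF inball[OF that]]
    interpret bounded_linear "G (z + s *\<^sub>R u + t *\<^sub>R v)" using gd by (rule has_derivative_bounded_linear)
    have "((\<lambda>s. z + s *\<^sub>R u + t *\<^sub>R v) has_derivative (\<lambda>c. c *\<^sub>R u)) (at s within {0..h})"
      by (auto intro!: derivative_eq_intros)
    from has_derivative_compose[OF this gd] show ?thesis
      by (simp add: scaleR)
  qed
  \<comment> \<open>The summand \<open>0 *\<^sub>R v\<close> is kept unsimplified so that
    \<open>der\<close> matches both terms, with \<open>t = h\<close> and
    \<open>t = 0\<close>.\<close>
  let ?q = "\<lambda>s. g (z + s *\<^sub>R u + h *\<^sub>R v) - g (z + s *\<^sub>R u + 0 *\<^sub>R v)"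
  have "\<exists>s\<in>{0..h}. ?q h - ?q 0 =
    (h - 0) * G (z + s *\<^sub>R u + h *\<^sub>R v) u - (h - 0) * G (z + s *\<^sub>R u + 0 *\<^sub>R v) u"
    using h(1) by (intro mvt_very_simple) (auto intro!: has_derivative_diff der simp del: scaleR_zero_left)
  then obtain s where s: "s \<in> {0..h}" and
    q: "?q h - ?q 0 = h * (G (z + s *\<^sub>R u + h *\<^sub>R v) u - G (z + s *\<^sub>R u) u)"
    by (auto simp: algebra_simps)
  have der2: "((\<lambda>t. G (z + s *\<^sub>R u + t *\<^sub>R v) u) has_derivative
      (\<lambda>c. c * K (z + s *\<^sub>R u + t *\<^sub>R v) v)) (at t within {0..h})"
    if "0 \<le> t" "t \<le> h" for t
  proof -
    note gd = G[OF inball[of s t]]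
    have gd: "((\<lambda>w. G w u) has_derivative K (z + s *\<^sub>R u + t *\<^sub>R v)) (at (z + s *\<^sub>R u + t *\<^sub>R v))"
      using s that by (intro gd) auto
    interpret bounded_linear "K (z + s *\<^sub>R u + t *\<^sub>R v)" using gd by (rule has_derivative_bounded_linear)
    have "((\<lambda>t. z + s *\<^sub>R u + t *\<^sub>R v) has_derivative (\<lambda>c. c *\<^sub>R v)) (at t within {0..h})"
      by (auto intro!: derivative_eq_intros)
    from has_derivative_compose[OF this gd] show ?thesis
      by (simp add: scaleR)
  qed
  have "\<exists>t\<in>{0..h}. G (z + s *\<^sub>R u + h *\<^sub>R v) u - G (z + s *\<^sub>R u + 0 *\<^sub>R v) u
    = (h - 0) * K (z + s *\<^sub>R u + t *\<^sub>R v) v"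
    using h(1) by (intro mvt_very_simple) (auto intro!: der2)
  then obtain t where t: "t \<in> {0..h}" and
    "G (z + s *\<^sub>R u + h *\<^sub>R v) u - G (z + s *\<^sub>R u) u = h * K (z + s *\<^sub>R u + t *\<^sub>R v) v"
    by auto
  with q have "?q h - ?q 0 = h * h * K (z + s *\<^sub>R u + t *\<^sub>R v) v"
    by simp
  moreover have "z + s *\<^sub>R u + t *\<^sub>R v \<in> ball z d" using s t by (intro inball) auto
  ultimately show ?thesis
    by (intro bexI[of _ "z + s *\<^sub>R u + t *\<^sub>R v"]) simp_all
qed

text \<open>The second difference is symmetric in \<open>u\<close> and \<open>v\<close>. Divided by
  \<open>h * h\<close> it is a value of each mixed derivative at some point near \<open>z\<close>,
  and continuity carries the equality to \<open>z\<close>.\<close>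

lemma symmetric_second_derivative_real:
  fixes g :: "'a::real_normed_vector \<Rightarrow> real"
  assumes U: "open U" "z \<in> U"
    and g: "\<And>w. w \<in> U \<Longrightarrow> (g has_derivative G w) (at w)"
    and Gu: "\<And>w. w \<in> U \<Longrightarrow> ((\<lambda>w. G w u) has_derivative K w) (at w)"
    and Gv: "\<And>w. w \<in> U \<Longrightarrow> ((\<lambda>w. G w v) has_derivative L w) (at w)"
    and contK: "continuous_on U (\<lambda>w. K w v)"
    and contL: "continuous_on U (\<lambda>w. L w u)"
  shows "K z v = L z u"
proof (rule ccontr)
  assume neq: "K z v \<noteq> L z u"
  define e where "e = \<bar>K z v - L z u\<bar> / 2"
  have e: "e > 0" using neq by (simp add: e_def)
  obtain d0 where d0: "d0 > 0" "ball z d0 \<subseteq> U" using U openE by blast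
  have "isCont (\<lambda>w. K w v) z" "isCont (\<lambda>w. L w u) z"
    using U contK contL continuous_on_eq_continuous_at by blast+
  then obtain d1 d2 where d1: "d1 > 0" "\<And>w. dist w z < d1 \<Longrightarrow> dist (K w v) (K z v) < e"
    and d2: "d2 > 0" "\<And>w. dist w z < d2 \<Longrightarrow> dist (L w u) (L z u) < e"
    using e unfolding continuous_at_eps_delta by metis
  define d where "d = min d0 (min d1 d2)"
  have d: "d > 0" "ball z d \<subseteq> U" using d0 d1 d2 by (auto simp: d_def)
  \<comment> \<open>Small enough for the parallelogram spanned by \<open>h *\<^sub>R u\<close> and
    \<open>h *\<^sub>R v\<close> to stay in the ball; the summand 1 covers
    \<open>u = v = 0\<close>.\<close>
  define h where "h = d / (2 * (norm u + norm v + 1))"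
  have pos: "norm u + norm v + 1 > 0"
    by (smt (verit) norm_ge_zero)
  have h: "h > 0" "h * (norm u + norm v) < d"
  proof -
    show "h > 0" using d pos by (simp add: h_def)
    then have "h * (norm u + norm v) < h * (2 * (norm u + norm v + 1))"
      using pos by (intro mult_strict_left_mono) auto
    also have "\<dots> = d" using pos by (simp add: h_def)
    finally show "h * (norm u + norm v) < d" .
  qed
  obtain \<xi> where \<xi>: "\<xi> \<in> ball z d"
    "g (z + h *\<^sub>R u + h *\<^sub>R v) - g (z + h *\<^sub>R u) - g (z + h *\<^sub>R v) + g z = h * h * K \<xi> v"
    using second_difference_mvt[of z d g G u K h v] g Gu d(2) h by blast
  obtain \<eta> where \<eta>: "\<eta> \<in> ball z d"
    "g (z + h *\<^sub>R v + h *\<^sub>R u) - g (z + h *\<^sub>R v) - g (z + h *\<^sub>R u) + g z = h * h * L \<eta> u"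
    using second_difference_mvt[of z d g G v L h u] g Gv d(2) h
    unfolding add.commute[of "norm u"] by blast
  have "h * h * K \<xi> v = h * h * L \<eta> u"
    unfolding \<xi>(2)[symmetric] \<eta>(2)[symmetric] by (simp add: add_ac)
  then have "K \<xi> v = L \<eta> u" using h by simp
  moreover have "dist (K \<xi> v) (K z v) < e" "dist (L \<eta> u) (L z u) < e"
    using \<xi>(1) \<eta>(1) by (auto intro!: d1 d2 simp: d_def dist_commute)
  ultimately show False
    unfolding e_def dist_real_def by (auto simp: abs_if field_simps split: if_splits)
qed

lemma Ck_on_2D:
  assumes "Ck_on 2 U f"
  shows "z \<in> U \<Longrightarrow> f differentiable (at z)"
    and "z \<in> U \<Longrightarrow> pd i f differentiable (at z)"
    and "continuous_on U (pd j (pd i f))"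
  using assms by (auto simp: numeral_2_eq_2)

lemma has_derivative_frechet:
  "f differentiable (at z) \<Longrightarrow> (f has_derivative frechet_derivative f (at z)) (at z)"
  by (simp add: frechet_derivative_works)

text \<open>Pairing with each basis vector reduces this to the real-valued case;
  \<open>Ck_on 2\<close> supplies the continuous second derivatives.\<close>

lemma pd_commute:
  fixes f :: "complex \<Rightarrow> 'b::euclidean_space"
  assumes U: "open U" "z \<in> U" and C2: "Ck_on 2 U f"
  shows "pd i (pd j f) z = pd j (pd i f) z"
proof (rule euclidean_eqI)
  fix e :: 'b
  note D = has_derivative_frechet
  have pd: "frechet_derivative F (at w) (coord_dir k) = pd k F w" for F :: "complex \<Rightarrow> 'b" and k w
    by (simp add: pd_def)
  have G: "((\<lambda>w. frechet_derivative f (at w) (coord_dir i) \<bullet> e) has_derivative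
      (\<lambda>h. frechet_derivative (pd i f) (at w) h \<bullet> e)) (at w)" if "w \<in> U" for w i
    using has_derivative_inner_left[OF D[OF Ck_on_2D(2)[OF C2 that, of i]], of e]
    by (simp add: pd)
  show "pd i (pd j f) z \<bullet> e = pd j (pd i f) z \<bullet> e"
    unfolding pd_def[of _ "pd _ f"]
  proof (rule symmetric_second_derivative_real[OF U])
    show "((\<lambda>w. f w \<bullet> e) has_derivative (\<lambda>h. frechet_derivative f (at w) h \<bullet> e)) (at w)" if "w \<in> U" for w
      by (intro has_derivative_inner_left D Ck_on_2D(1)[OF C2 that])
    show "continuous_on U (\<lambda>w. frechet_derivative (pd j f) (at w) (coord_dir i) \<bullet> e)"
      "continuous_on U (\<lambda>w. frechet_derivative (pd i f) (at w) (coord_dir j) \<bullet> e)"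
      using Ck_on_2D(3)[OF C2, of i j] Ck_on_2D(3)[OF C2, of j i]
      unfolding pd by (auto intro!: continuous_on_inner continuous_on_const)
  qed (rule G, assumption)+
qed

section \<open>Differentiability of continuous square roots\<close>

lemma differentiable_transform_open:
  assumes "f differentiable (at z)" "open V" "z \<in> V" "\<And>w. w \<in> V \<Longrightarrow> f w = g w"
  shows "g differentiable (at z)"
  using assms has_derivative_transform_within_open unfolding differentiable_def by blast

text \<open>By continuity \<open>g w / g z\<close> has positive real part near \<open>z\<close>, so
  the principal root recovers it from its square, and \<open>csqrt\<close> is differentiable at
  1.\<close>

lemma differentiable_of_square:
  fixes g :: "'a::real_normed_vector \<Rightarrow> complex"
  assumes U: "open U" "z \<in> U" and cont: "continuous_on U g"
    and sq: "(\<lambda>w. (g w)\<^sup>2) differentiable (at z)" and nz: "g z \<noteq> 0"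
  shows "g differentiable (at z)"
proof -
  define V where "V = U \<inter> (\<lambda>w. g w / g z) -` {c. 0 < Re c}"
  have "continuous_on U (\<lambda>w. g w / g z)" using cont nz by (intro continuous_intros) auto
  then have V: "open V" unfolding V_def
    by (intro continuous_open_preimage U open_halfspace_Re_gt)
  have "z \<in> V" using U nz by (simp add: V_def)
  have eq: "csqrt ((g w)\<^sup>2 / (g z)\<^sup>2) * g z = g w" if "w \<in> V" for w
    using that nz csqrt_square[of "g w / g z"] by (simp add: V_def power_divide)
  have "(\<lambda>w. csqrt ((g w)\<^sup>2 / (g z)\<^sup>2) * g z) differentiable (at z)"
  proof -
    obtain D where D: "((\<lambda>w. (g w)\<^sup>2) has_derivative D) (at z)" using sq by (auto simp: differentiable_def)
    have 1: "((\<lambda>w. (g w)\<^sup>2 / (g z)\<^sup>2) has_derivative (\<lambda>h. D h / (g z)\<^sup>2)) (at z)"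
      by (rule bounded_linear.has_derivative[OF bounded_linear_divide D])
    have "(csqrt has_field_derivative (inverse (2 * csqrt 1))) (at 1)"
      by (rule has_field_derivative_csqrt) simp
    then have 2: "(csqrt has_derivative (*) (inverse (2 * csqrt 1))) (at ((g z)\<^sup>2 / (g z)\<^sup>2))"
      using nz by (simp add: has_field_derivative_def)
    show ?thesis
      using has_derivative_mult_left[OF has_derivative_compose[OF 1 2]] by (auto simp: differentiable_def)
  qed
  then show ?thesis
    by (rule differentiable_transform_open[OF _ V \<open>z \<in> V\<close> eq])
qed

lemma differentiable_cnj: "g differentiable (at z) \<Longrightarrow> (\<lambda>w. cnj (g w)) differentiable (at z)"
  unfolding differentiable_def using bounded_linear.has_derivative[OF bounded_linear_cnj] by blast

lemma differentiable_factor: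
  fixes g h :: "'a::real_normed_vector \<Rightarrow> complex"
  assumes U: "open U" "z \<in> U" and cont: "continuous_on U g"
    and g: "g differentiable (at z)" and gh: "(\<lambda>w. g w * h w) differentiable (at z)"
    and nz: "g z \<noteq> 0"
  shows "h differentiable (at z)"
proof -
  have V: "open (U \<inter> g -` (- {0}))" by (intro continuous_open_preimage cont U) auto
  have "(\<lambda>w. (g w * h w) / g w) differentiable (at z)"
    using nz by (intro differentiable_divide g gh)
  then show ?thesis
    by (rule differentiable_transform_open[OF _ V]) (use U nz in auto)
qed

text \<open>A component that is nonzero at \<open>z\<close> is a root of its differentiable square;
  dividing the mixed product by it gives the other one.\<close>

lemma spinor_differentiable:
  fixes a b :: "'a::real_normed_vector \<Rightarrow> complex"
  assumes U: "open U" "z \<in> U" and cont: "continuous_on U a" "continuous_on U b"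
    and d: "(\<lambda>w. (a w)\<^sup>2) differentiable (at z)" "(\<lambda>w. (cnj (b w))\<^sup>2) differentiable (at z)"
      "(\<lambda>w. a w * cnj (b w)) differentiable (at z)"
    and nz: "a z \<noteq> 0 \<or> b z \<noteq> 0"
  shows "a differentiable (at z)" "b differentiable (at z)"
proof -
  have c: "continuous_on U (\<lambda>w. cnj (b w))" using cont by (intro continuous_intros)
  have *: "a differentiable (at z) \<and> (\<lambda>w. cnj (b w)) differentiable (at z)"
  proof (cases "a z = 0")
    case False
    then show ?thesis
      using differentiable_of_square[OF U cont(1) d(1)] differentiable_factor[OF U cont(1) _ d(3)] by blast
  next
    case True
    then show ?thesis
      using differentiable_of_square[OF U c d(2)] differentiable_factor[OF U c, of a] d(3) nz
      by (simp add: mult.commute)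
  qed
  then show "a differentiable (at z)" "b differentiable (at z)"
    using differentiable_cnj[of "\<lambda>w. cnj (b w)" z] by auto
qed

section \<open>Algebra of spinors\<close>

text \<open>Writing \<open>(p, q) = (x b + y a, - x (cnj a) + y (cnj b))\<close> and \<open>m = x - cnj x - \<i> r\<close>,
  the equations become linear in \<open>y\<close>, \<open>cnj y\<close> and \<open>m\<close>, and elimination gives
  \<open>r\<^sup>2 (cnj y) = 0\<close>.\<close>

lemma spinor_structure_equations:
  fixes a b p q :: complex
  defines "r \<equiv> (cmod a)\<^sup>2 + (cmod b)\<^sup>2"
  assumes nz: "a \<noteq> 0 \<or> b \<noteq> 0"
    and E1: "cnj b * q + cnj a * cnj p = - \<i> * of_real r * (cnj a * cnj b)"
    and E2: "cnj b * p + a * q - (b * cnj p + cnj a * cnj q) = \<i> * of_real r * (b * cnj b - a * cnj a)"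
  shows "\<exists>x. p = x * b \<and> q = - x * cnj a \<and> Im x = r / 2"
proof -
  have r: "of_real r = a * cnj a + b * cnj b"
    unfolding r_def by (simp add: complex_norm_square flip: of_real_power)
  have "r \<noteq> 0" using nz by (auto simp: r_def add_nonneg_eq_0_iff)
  \<comment> \<open>Coordinates of \<open>(p, q)\<close> in the vectors \<open>(b, - cnj a)\<close>
    and \<open>(a, cnj b)\<close>, which are Hermitian orthogonal of squared length
    \<open>r\<close>.\<close>
  define x where "x = (p * cnj b - q * a) / of_real r"
  define y where "y = (p * cnj a + q * b) / of_real r"
  have p: "p = x * b + y * a"
    using \<open>r \<noteq> 0\<close> by (simp add: x_def y_def divide_simps) (simp add: r algebra_simps)
  have q: "q = - x * cnj a + y * cnj b"
    using \<open>r \<noteq> 0\<close> by (simp add: x_def y_def divide_simps) (simp add: r algebra_simps)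
  \<comment> \<open>\<open>m = \<i> * (2 * Im x - r)\<close> is purely imaginary, and
    \<open>m = 0\<close> is the claim about \<open>Im x\<close>.\<close>
  define m where "m = x - cnj x - \<i> * of_real r"
  have F1: "y * (cnj b)\<^sup>2 + cnj y * (cnj a)\<^sup>2 = m * cnj a * cnj b"
    using E1 unfolding p q m_def by (simp add: algebra_simps power2_eq_square)
  have "cnj m = - m" by (simp add: m_def)
  then have F1': "cnj y * b\<^sup>2 + y * a\<^sup>2 = - m * a * b"
    using arg_cong[OF F1, of cnj] by simp
  have F2: "m * (b * cnj b - a * cnj a) + 2 * y * a * cnj b - 2 * cnj y * cnj a * b = 0"
    using E2 unfolding p q m_def by (simp add: algebra_simps)
  \<comment> \<open>The multipliers of \<open>F1\<close>, \<open>F1'\<close> and \<open>F2\<close>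
    are chosen so that all terms in \<open>m\<close> and in \<open>y\<close> cancel and
    \<open>cnj y\<close> keeps the coefficient
    \<open>(a * cnj a + b * cnj b)\<^sup>2\<close>.\<close>
  have "cnj y * (of_real r)\<^sup>2 = a\<^sup>2 * (y * (cnj b)\<^sup>2 + cnj y * (cnj a)\<^sup>2 - m * cnj a * cnj b)
      + (cnj b)\<^sup>2 * (cnj y * b\<^sup>2 + y * a\<^sup>2 - (- m * a * b))
      - a * cnj b * (m * (b * cnj b - a * cnj a) + 2 * y * a * cnj b - 2 * cnj y * cnj a * b)"
    unfolding r by (simp add: algebra_simps power2_eq_square)
  then have "cnj y * (of_real r)\<^sup>2 = 0" unfolding F1 F1' F2 by simp
  then have y: "y = 0" using \<open>r \<noteq> 0\<close> by simp
  \<comment> \<open>The factors of \<open>m\<close> vanish together only if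
    \<open>a = b = 0\<close>.\<close>
  have "m * a * b = 0" "m * (b * cnj b - a * cnj a) = 0" using F1' F2 y by auto
  then have m: "m = 0" using nz by auto
  then have "Im m = 0" by simp
  then have "Im x = r / 2" by (simp add: m_def)
  with p q y show ?thesis by auto
qed

section \<open>Coordinates in the complexification of su(2)\<close>

lemma cscale_nth [simp]: "cscale c A $ i $ j = c * A $ i $ j"
  by (simp add: cscale_def map_matrix_def)

lemma cscale_arith:
  fixes A B :: "complex^2^2"
  shows "cscale c (cscale d A) = cscale (c * d) A" "cscale 1 A = A"
    "A ** cscale c B = cscale c (A ** B)"
  by (simp_all add: vec_eq_iff matrix_matrix_mult_def sum_distrib_left algebra_simps)

text \<open>A general element of sl(2,C), the complexification of su(2), in which \<open>Psi\<close>
  lies; identities between matrices become identities between three coordinates.\<close>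

definition su2_comb :: "complex \<Rightarrow> complex \<Rightarrow> complex \<Rightarrow> complex^2^2" where
  "su2_comb u v w = cscale u (su2_basis $ 1) + cscale v (su2_basis $ 2) + cscale w (su2_basis $ 3)"

lemma su2_comb_nth:
  "su2_comb u v w $ 1 $ 1 = \<i> * u" "su2_comb u v w $ 1 $ 2 = v + \<i> * w"
  "su2_comb u v w $ 2 $ 1 = - v + \<i> * w" "su2_comb u v w $ 2 $ 2 = - \<i> * u"
  by (simp_all add: su2_comb_def cscale_def su2_basis_def map_matrix_def)

lemma su2_comb_eq_iff: "su2_comb u v w = su2_comb u' v' w' \<longleftrightarrow> u = u' \<and> v = v' \<and> w = w'"
proof
  assume *: "su2_comb u v w = su2_comb u' v' w'"
  have "v + \<i> * w = v' + \<i> * w'" "- v + \<i> * w = - v' + \<i> * w'" "\<i> * u = \<i> * u'"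
    using * by (metis su2_comb_nth)+
  then show "u = u' \<and> v = v' \<and> w = w'"
    by (auto simp: complex_eq_iff)
qed simp

lemma su2_comb_eqI:
  fixes A :: "complex^2^2"
  assumes "A $ 1 $ 1 = \<i> * u" "A $ 1 $ 2 = v + \<i> * w" "A $ 2 $ 1 = - v + \<i> * w" "A $ 2 $ 2 = - \<i> * u"
  shows "A = su2_comb u v w"
  using assms by (simp add: vec_eq_iff forall_2 su2_comb_nth)

lemma scaleR_eq_cscale: "t *\<^sub>R (A :: complex^'n^'m) = cscale (of_real t) A"
  by (simp add: vec_eq_iff scaleR_conv_of_real[where 'a = complex])

lemma su2_comb_arith:
  "su2_comb u v w + su2_comb u' v' w' = su2_comb (u + u') (v + v') (w + w')"
  "su2_comb u v w - su2_comb u' v' w' = su2_comb (u - u') (v - v') (w - w')"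
  "cscale c (su2_comb u v w) = su2_comb (c * u) (c * v) (c * w)"
  by (rule su2_comb_eqI; simp add: su2_comb_nth algebra_simps)+

lemma bounded_linear_cscale: "bounded_linear (\<lambda>c. cscale c (A :: complex^2^2))"
  by (intro linear_conv_bounded_linear[THEN iffD1] linearI)
    (simp_all add: vec_eq_iff distrib_right)

lemma has_derivative_su2_comb:
  assumes "(u has_derivative Du) F" "(v has_derivative Dv) F" "(w has_derivative Dw) F"
  shows "((\<lambda>z. su2_comb (u z) (v z) (w z)) has_derivative (\<lambda>h. su2_comb (Du h) (Dv h) (Dw h))) F"
  unfolding su2_comb_def
  by (intro has_derivative_add bounded_linear.has_derivative[OF bounded_linear_cscale] assms)

lemma Psi_eq_su2_comb:
  "Psi p = su2_comb (spinor_Z p $ 1) (spinor_Z p $ 2) (spinor_Z p $ 3)"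
  "Psi_star p = su2_comb (cnj (spinor_Z p $ 1)) (cnj (spinor_Z p $ 2)) (cnj (spinor_Z p $ 3))"
  by (simp_all add: Psi_def Psi_star_def sum_3 su2_comb_def)

lemma spinor_Z_nth:
  "spinor_Z p $ 1 = \<i> / 2 * ((cnj (p $ 2))\<^sup>2 + (p $ 1)\<^sup>2)"
  "spinor_Z p $ 2 = 1 / 2 * ((cnj (p $ 2))\<^sup>2 - (p $ 1)\<^sup>2)"
  "spinor_Z p $ 3 = p $ 1 * cnj (p $ 2)"
  by (simp_all add: spinor_Z_def)

text \<open>A form of the Hopf map: the coordinates are the real numbers
  \<open>- 2 Im (a b)\<close>, \<open>- 2 Re (a b)\<close> and \<open>|b|^2 - |a|^2\<close>, and the
  length is \<open>spinor_density p\<close>.\<close>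

definition spinor_normal :: "complex^2 \<Rightarrow> complex^2^2" where
  "spinor_normal p = su2_comb (\<i> * (p $ 1 * p $ 2 - cnj (p $ 1) * cnj (p $ 2)))
     (- (p $ 1 * p $ 2 + cnj (p $ 1) * cnj (p $ 2))) (p $ 2 * cnj (p $ 2) - p $ 1 * cnj (p $ 1))"

text \<open>On the surface this is the conformal factor \<open>e^\<alpha>\<close>; see
  \<open>exp_\<alpha>\<close>.\<close>

definition spinor_density :: "complex^2 \<Rightarrow> real" where
  "spinor_density p = (cmod (p $ 1))\<^sup>2 + (cmod (p $ 2))\<^sup>2"

lemma of_real_spinor_density:
  "of_real (spinor_density p) = p $ 1 * cnj (p $ 1) + p $ 2 * cnj (p $ 2)"
  unfolding spinor_density_def by (simp add: complex_norm_square flip: of_real_power)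

lemma commutator_su2_comb:
  "commutator (su2_comb u v w) (su2_comb u' v' w') =
     su2_comb (2 * (v * w' - w * v')) (2 * (w * u' - u * w')) (2 * (u * v' - v * u'))"
  by (rule su2_comb_eqI; simp add: commutator_def matrix_matrix_mult_def sum_2 su2_comb_nth algebra_simps)

lemma commutator_Psi:
  "commutator (Psi p) (Psi_star p) = cscale (\<i> * of_real (spinor_density p)) (spinor_normal p)"
  by (simp add: Psi_eq_su2_comb commutator_su2_comb spinor_normal_def su2_comb_arith su2_comb_eq_iff
      spinor_Z_nth of_real_spinor_density) (simp add: field_simps power2_eq_square)

text \<open>The first two coordinates force \<open>a b = 0\<close>, the third
  \<open>|a| = |b|\<close>.\<close>

lemma spinor_normal_eq_0_iff: "spinor_normal p = 0 \<longleftrightarrow> p = 0"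
proof
  have "su2_comb 0 0 0 = 0" using su2_comb_arith(3)[of 0 0 0 0] by (simp add: vec_eq_iff)
  moreover assume "spinor_normal p = 0"
  ultimately have "\<i> * (p $ 1 * p $ 2 - cnj (p $ 1) * cnj (p $ 2)) = 0"
     "- (p $ 1 * p $ 2 + cnj (p $ 1) * cnj (p $ 2)) = 0" "p $ 2 * cnj (p $ 2) - p $ 1 * cnj (p $ 1) = 0"
    unfolding spinor_normal_def by (metis su2_comb_eq_iff)+
  then have "p $ 1 * p $ 2 = 0" "p $ 2 * cnj (p $ 2) = p $ 1 * cnj (p $ 1)" by auto
  then show "p = 0" by (auto simp: vec_eq_iff forall_2)
next
  assume "p = 0"
  then show "spinor_normal p = 0"
    by (simp add: spinor_normal_def vec_eq_iff forall_2 su2_comb_nth)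
qed

lemma su2_inner_su2_comb:
  "su2_inner (su2_comb u v w) (su2_comb u' v' w') = Re (u * u' + v * v' + w * w')"
  by (simp add: su2_inner_def trace_def matrix_matrix_mult_def sum_2 su2_comb_nth algebra_simps)

text \<open>\<open>Psi p + Psi_star p\<close> is the left translate of the x-derivative of
  \<open>f\<close>, so this computes a coefficient of the induced metric.\<close>

lemma su2_inner_spinor:
  "su2_inner (Psi p + Psi_star p) (Psi p + Psi_star p) = (spinor_density p)\<^sup>2"
proof -
  let ?u = "\<lambda>j. spinor_Z p $ j + cnj (spinor_Z p $ j)"
  have "?u 1 * ?u 1 + ?u 2 * ?u 2 + ?u 3 * ?u 3 = (of_real (spinor_density p))\<^sup>2"
    unfolding of_real_spinor_density spinor_Z_nth
    by (simp add: algebra_simps power2_eq_square)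
  then show ?thesis
    unfolding Psi_eq_su2_comb su2_comb_arith su2_inner_su2_comb by (simp flip: of_real_power)
qed

section \<open>Geometry of the surface\<close>

lemma bounded_bilinear_matrix_mult:
  "bounded_bilinear ((**) :: complex^2^2 \<Rightarrow> complex^2^2 \<Rightarrow> complex^2^2)"
  unfolding bilinear_conv_bounded_bilinear[symmetric] bilinear_def
  by (intro conjI allI linearI)
    (simp_all add: vec_eq_iff matrix_matrix_mult_def scaleR_add_right sum_2 algebra_simps)

lemma pd_eqI: "(f has_derivative D) (at z) \<Longrightarrow> pd i f z = D (coord_dir i)"
  by (simp add: pd_def flip: frechet_derivative_at)

text \<open>Both functions have the same derivatives at \<open>z\<close>, so the choice operator in
  \<open>frechet_derivative\<close> picks the same map, also when no derivative exists.\<close>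

lemma pd_cong_open:
  assumes V: "open V" "z \<in> V" and eq: "\<And>w. w \<in> V \<Longrightarrow> f w = g w"
  shows "pd i f z = pd i g z"
proof -
  have "(f has_derivative D) (at z) \<longleftrightarrow> (g has_derivative D) (at z)" for D
    using has_derivative_transform_within_open[OF _ V, of f D UNIV g]
      has_derivative_transform_within_open[OF _ V, of g D UNIV f] eq by auto
  then show ?thesis by (simp add: pd_def frechet_derivative_def)
qed

lemma pd_matrix_mult:
  fixes F G :: "complex \<Rightarrow> complex^2^2"
  assumes "F differentiable (at z)" "G differentiable (at z)"
  shows "pd i (\<lambda>w. F w ** G w) z = pd i F z ** G z + F z ** pd i G z"
proof -
  have "((\<lambda>w. F w ** G w) has_derivative
      (\<lambda>h. F z ** frechet_derivative G (at z) h + frechet_derivative F (at z) h ** G z)) (at z)"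
    by (rule bounded_bilinear.FDERIV[OF bounded_bilinear_matrix_mult])
      (rule has_derivative_frechet assms)+
  then have "pd i (\<lambda>w. F w ** G w) z = F z ** pd i G z + pd i F z ** G z"
    unfolding pd_def[of i F] pd_def[of i G] by (rule pd_eqI)
  then show ?thesis by (simp add: add.commute)
qed

lemma matrix_inv_eqI:
  fixes A B :: "'a::semiring_1^'n^'n"
  assumes "A ** B = mat 1" "B ** A = mat 1"
  shows "matrix_inv A = B"
proof -
  have *: "A ** matrix_inv A = mat 1 \<and> matrix_inv A ** A = mat 1"
    unfolding matrix_inv_def using assms by (rule_tac someI[of _ B]) simp
  then have "matrix_inv A = (B ** A) ** matrix_inv A" using assms by simp
  also have "\<dots> = B" using * by (simp flip: matrix_mul_assoc)
  finally show ?thesis .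
qed

lemma SU2_inverse:
  assumes "A \<in> SU2"
  shows "matrix_inv A = map_matrix cnj (transpose A)" "matrix_inv A ** A = mat 1"
proof -
  have 1: "map_matrix cnj (transpose A) ** A = mat 1" using assms by (simp add: SU2_def)
  then have 2: "A ** map_matrix cnj (transpose A) = mat 1" by (simp add: matrix_left_right_inverse)
  show "matrix_inv A = map_matrix cnj (transpose A)" by (rule matrix_inv_eqI[OF 2 1])
  then show "matrix_inv A ** A = mat 1" using 1 by simp
qed

lemma SU2_cancel:
  fixes X Y :: "complex^2^2"
  assumes "A \<in> SU2"
  shows "matrix_inv A ** (A ** X) = X" "A ** X = A ** Y \<longleftrightarrow> X = Y"
proof -
  show *: "matrix_inv A ** (A ** X) = X" for X :: "complex^2^2"
    by (simp only: matrix_mul_assoc SU2_inverse(2)[OF assms] matrix_mul_lid)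
  show "A ** X = A ** Y \<longleftrightarrow> X = Y" by (metis *)
qed

lemma bounded_linear_adjoint: "bounded_linear (\<lambda>A :: complex^2^2. map_matrix cnj (transpose A))"
  by (intro linear_conv_bounded_linear[THEN iffD1] linearI)
    (simp_all add: vec_eq_iff map_matrix_def transpose_def)

text \<open>The product rule gives \<open>f (\<xi> i \<xi> j + pd i (\<xi> j))\<close> for the
  second derivative; it is symmetric in \<open>i\<close> and \<open>j\<close>, and \<open>f\<close>
  cancels.\<close>

lemma maurer_cartan:
  fixes f :: "complex \<Rightarrow> complex^2^2"
  assumes U: "open U" "z \<in> U" and C2: "Ck_on 2 U f" and SU: "f ` U \<subseteq> SU2"
    and pd: "\<And>i w. w \<in> U \<Longrightarrow> pd i f w = f w ** \<xi> i w"
    and d: "\<And>i. \<xi> i differentiable (at z)"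
  shows "pd i (\<xi> j) z - pd j (\<xi> i) z + commutator (\<xi> i z) (\<xi> j z) = 0"
proof -
  have second: "pd i (pd j f) z = f z ** (\<xi> i z ** \<xi> j z + pd i (\<xi> j) z)" for i j
  proof -
    have "pd i (pd j f) z = pd i (\<lambda>w. f w ** \<xi> j w) z"
      by (rule pd_cong_open[OF U pd])
    also have "\<dots> = f z ** \<xi> i z ** \<xi> j z + f z ** pd i (\<xi> j) z"
      using Ck_on_2D(1)[OF C2 U(2)] d by (simp add: pd_matrix_mult pd U(2))
    finally show ?thesis by (simp add: matrix_add_ldistrib matrix_mul_assoc)
  qed
  have "f z \<in> SU2" using SU U by auto
  then have "\<xi> i z ** \<xi> j z + pd i (\<xi> j) z = \<xi> j z ** \<xi> i z + pd j (\<xi> i) z"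
    using pd_commute[OF U C2, of i j] unfolding second by (simp add: SU2_cancel)
  then show ?thesis by (simp add: commutator_def algebra_simps)
qed

lemma differentiable_vec2:
  fixes \<psi> :: "'a::real_normed_vector \<Rightarrow> complex^2"
  assumes "(\<lambda>w. \<psi> w $ 1) differentiable (at z)" "(\<lambda>w. \<psi> w $ 2) differentiable (at z)"
  shows "\<psi> differentiable (at z)"
proof -
  have "bounded_linear (axis k :: complex \<Rightarrow> complex^2)" for k
    by (intro linear_conv_bounded_linear[THEN iffD1] linearI) (simp_all add: vec_eq_iff axis_def)
  then have "(\<lambda>w. axis k (\<psi> w $ k) :: complex^2) differentiable (at z)"
    if "(\<lambda>w. \<psi> w $ k) differentiable (at z)" for k
    using that bounded_linear.has_derivative[of "axis k"] unfolding differentiable_def by blast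
  then have "(\<lambda>w. axis 1 (\<psi> w $ 1) + axis 2 (\<psi> w $ 2) :: complex^2) differentiable (at z)"
    using assms by (intro differentiable_add)
  moreover have "(\<lambda>w. axis 1 (\<psi> w $ 1) + axis 2 (\<psi> w $ 2) :: complex^2) = \<psi>"
    by (simp add: fun_eq_iff vec_eq_iff forall_2 axis_def)
  ultimately show ?thesis by simp
qed

lemma coord_dir_simps [simp]: "coord_dir 1 = 1" "coord_dir 2 = \<i>"
  by (simp_all add: coord_dir_def)

lemma pd_nth:
  fixes F :: "complex \<Rightarrow> complex^2^2"
  assumes "F differentiable (at z)"
  shows "pd i (\<lambda>w. F w $ j $ k) z = pd i F z $ j $ k"
  unfolding pd_def[of i F]
  by (rule pd_eqI, rule bounded_linear.has_derivative[OF bounded_linear_vec_nth],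
      rule bounded_linear.has_derivative[OF bounded_linear_vec_nth])
    (rule has_derivative_frechet[OF assms])

section \<open>The spinor and the Maurer-Cartan form of the surface\<close>

text \<open>The matrices \<open>\<xi> i = f\<^sup>-\<^sup>1 \<cdot> \<partial>\<^sub>i f\<close> below are the components of the
  pulled back Maurer-Cartan form.\<close>

locale conformal_spinor_surface =
  fixes U :: "complex set" and f :: "complex \<Rightarrow> complex^2^2"
    and \<alpha> :: "complex \<Rightarrow> real" and \<psi> :: "complex \<Rightarrow> complex^2"
  assumes U: "open U" and imm: "immersion_on U f"
    and conf: "conformal_parameter U f \<alpha>" and spin: "spinor_field U f \<psi>"
begin

definition \<xi> :: "2 \<Rightarrow> complex \<Rightarrow> complex^2^2" where
  "\<xi> i w = cscale (coord_dir i) (Psi (\<psi> w)) + cscale (cnj (coord_dir i)) (Psi_star (\<psi> w))"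

lemma C2: "Ck_on 2 U f" and f_SU2: "w \<in> U \<Longrightarrow> f w \<in> SU2"
  using imm by (auto simp: immersion_on_def)

lemma frechet_f:
  "w \<in> U \<Longrightarrow> frechet_derivative f (at w) v =
     f w ** (cscale v (Psi (\<psi> w)) + cscale (cnj v) (Psi_star (\<psi> w)))"
  using spin by (subst frechet_derivative_at[symmetric]) (auto simp: spinor_field_def)

lemma pd_f: "w \<in> U \<Longrightarrow> pd i f w = f w ** \<xi> i w"
  by (simp add: pd_def frechet_f \<xi>_def)

lemma \<xi>_eq: "w \<in> U \<Longrightarrow> \<xi> i w = matrix_inv (f w) ** pd i f w"
  by (simp add: pd_f f_SU2 SU2_cancel)

text \<open>On \<open>SU2\<close> the inverse is the adjoint, a real-linear map, so
  \<open>\<xi> i\<close> is a product of differentiable functions.\<close>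

lemma \<xi>_differentiable:
  assumes "w \<in> U" shows "\<xi> i differentiable (at w)"
proof -
  have "(\<lambda>z. map_matrix cnj (transpose (f z)) ** pd i f z) differentiable (at w)"
    by (rule differentiableI, rule bounded_bilinear.FDERIV[OF bounded_bilinear_matrix_mult],
        rule bounded_linear.has_derivative[OF bounded_linear_adjoint])
      (rule has_derivative_frechet Ck_on_2D[OF C2] assms)+
  then show ?thesis
    by (rule differentiable_transform_open[OF _ U assms])
      (simp add: \<xi>_eq SU2_inverse(1) f_SU2)
qed

text \<open>Conformality evaluated at \<open>v = w = 1\<close>: both sides are the squared length of
  the x-derivative of \<open>f\<close>.\<close>

lemma exp_\<alpha>: "exp (2 * \<alpha> w) = (spinor_density (\<psi> w))\<^sup>2" if w: "w \<in> U"
proof -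
  have "exp (2 * \<alpha> w) = induced_metric f w 1 1"
    using conf w by (simp add: conformal_parameter_def)
  also have "\<dots> = su2_inner (Psi (\<psi> w) + Psi_star (\<psi> w)) (Psi (\<psi> w) + Psi_star (\<psi> w))"
    using w by (simp add: induced_metric_def SU2_metric_def frechet_f f_SU2 SU2_cancel cscale_arith)
  finally show ?thesis by (simp add: su2_inner_spinor)
qed

lemma spinor_density_pos: "w \<in> U \<Longrightarrow> spinor_density (\<psi> w) > 0"
  using exp_\<alpha>[of w] exp_gt_zero[of "2 * \<alpha> w"]
  by (auto simp: spinor_density_def less_le)

lemma \<psi>_nonzero: "w \<in> U \<Longrightarrow> \<psi> w $ 1 \<noteq> 0 \<or> \<psi> w $ 2 \<noteq> 0"
  using spinor_density_pos[of w] by (auto simp: spinor_density_def)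

lemma Psi_\<xi>: "Psi (\<psi> w) = cscale (1/2) (\<xi> 1 w - cscale \<i> (\<xi> 2 w))"
  by (simp add: \<xi>_def vec_eq_iff algebra_simps)

lemma \<psi>_component_differentiable:
  assumes w: "w \<in> U"
  shows "(\<lambda>z. \<psi> z $ 1) differentiable (at w)" "(\<lambda>z. \<psi> z $ 2) differentiable (at w)"
proof -
  have \<xi>: "(\<lambda>z. \<xi> i z $ j $ k) differentiable (at w)" for i j k
    using bounded_linear.has_derivative[OF bounded_linear_vec_nth
        bounded_linear.has_derivative[OF bounded_linear_vec_nth
          has_derivative_frechet[OF \<xi>_differentiable[OF w, of i]]], of j k]
    unfolding differentiable_def by blast
  have P: "(\<lambda>z. Psi (\<psi> z) $ j $ k) differentiable (at w)" for j k
    unfolding Psi_\<xi> cscale_nth vector_minus_component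
    by (intro differentiable_mult differentiable_diff \<xi> differentiable_const)
  \<comment> \<open>The diagonal of \<open>Psi\<close> carries the sum of the two squares, the
    antisymmetric part their difference, and the symmetric off-diagonal part the product.\<close>
  have eqs: "(\<psi> z $ 1)\<^sup>2 = - Psi (\<psi> z) $ 1 $ 1 - 1/2 * (Psi (\<psi> z) $ 1 $ 2 - Psi (\<psi> z) $ 2 $ 1)"
    "(cnj (\<psi> z $ 2))\<^sup>2 = - Psi (\<psi> z) $ 1 $ 1 + 1/2 * (Psi (\<psi> z) $ 1 $ 2 - Psi (\<psi> z) $ 2 $ 1)"
    "\<psi> z $ 1 * cnj (\<psi> z $ 2) = - \<i> / 2 * (Psi (\<psi> z) $ 1 $ 2 + Psi (\<psi> z) $ 2 $ 1)" for z
    by (simp_all add: Psi_eq_su2_comb su2_comb_nth spinor_Z_nth field_simps)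
  have cont: "continuous_on U (\<lambda>z. \<psi> z $ k)" for k
    using spin by (auto simp: spinor_field_def intro: continuous_intros)
  note * = spinor_differentiable[OF U w cont cont _ _ _ \<psi>_nonzero[OF w], unfolded eqs]
  show "(\<lambda>z. \<psi> z $ 1) differentiable (at w)" "(\<lambda>z. \<psi> z $ 2) differentiable (at w)"
    by (rule *; intro differentiable_add differentiable_diff differentiable_mult
        differentiable_minus differentiable_const P)+
qed

lemma \<psi>_differentiable: "w \<in> U \<Longrightarrow> \<psi> differentiable (at w)"
  by (intro differentiable_vec2 \<psi>_component_differentiable)

lemma \<xi>_su2_comb:
  "\<xi> i w = su2_comb (coord_dir i * spinor_Z (\<psi> w) $ 1 + cnj (coord_dir i) * cnj (spinor_Z (\<psi> w) $ 1))
     (coord_dir i * spinor_Z (\<psi> w) $ 2 + cnj (coord_dir i) * cnj (spinor_Z (\<psi> w) $ 2))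
     (coord_dir i * spinor_Z (\<psi> w) $ 3 + cnj (coord_dir i) * cnj (spinor_Z (\<psi> w) $ 3))"
  by (simp add: \<xi>_def Psi_eq_su2_comb su2_comb_arith)

lemma \<xi>_commutator:
  "commutator (\<xi> 1 w) (\<xi> 2 w) =
     cscale (2 * of_real (spinor_density (\<psi> w))) (spinor_normal (\<psi> w))"
proof -
  \<comment> \<open>Here \<open>\<xi> 1 = Psi + Psi_star\<close> and
    \<open>\<xi> 2 = \<i> (Psi - Psi_star)\<close>.\<close>
  have "commutator (\<xi> 1 w) (\<xi> 2 w) = cscale (- 2 * \<i>) (commutator (Psi (\<psi> w)) (Psi_star (\<psi> w)))"
    by (simp add: \<xi>_su2_comb Psi_eq_su2_comb commutator_su2_comb su2_comb_arith su2_comb_eq_iff algebra_simps)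
  then show ?thesis by (simp add: commutator_Psi cscale_arith mult.assoc)
qed

text \<open>The numbers \<open>d1\<close>, \<open>d2\<close>, \<open>d3\<close> are the
  \<open>delbar\<close> derivatives of the coordinates of \<open>Psi\<close>, with \<open>q\<close>
  the \<open>delbar\<close> derivative of \<open>cnj b\<close>. The curl of \<open>\<xi>\<close> is
  \<open>2 \<i> (delbar Psi - del Psi_star)\<close>, its divergence
  \<open>2 (delbar Psi + del Psi_star)\<close>.\<close>

lemma \<xi>_derivatives:
  fixes w :: complex
  defines "a \<equiv> \<psi> w $ 1" and "b \<equiv> \<psi> w $ 2"
    and "p \<equiv> delbar (\<lambda>z. \<psi> z $ 1) w" and "q \<equiv> cnj (del (\<lambda>z. \<psi> z $ 2) w)"
  defines "d1 \<equiv> \<i> * (cnj b * q + a * p)" and "d2 \<equiv> cnj b * q - a * p" and "d3 \<equiv> p * cnj b + a * q"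
  assumes w: "w \<in> U"
  shows "pd 1 (\<xi> 2) w - pd 2 (\<xi> 1) w =
           su2_comb (2 * \<i> * (d1 - cnj d1)) (2 * \<i> * (d2 - cnj d2)) (2 * \<i> * (d3 - cnj d3))"
    and "pd 1 (\<xi> 1) w + pd 2 (\<xi> 2) w =
           su2_comb (2 * (d1 + cnj d1)) (2 * (d2 + cnj d2)) (2 * (d3 + cnj d3))"
proof -
  define A where "A = frechet_derivative (\<lambda>z. \<psi> z $ 1) (at w)"
  define B where "B = frechet_derivative (\<lambda>z. \<psi> z $ 2) (at w)"
  have A: "((\<lambda>z. \<psi> z $ 1) has_derivative A) (at w)" and B: "((\<lambda>z. \<psi> z $ 2) has_derivative B) (at w)"
    using \<psi>_component_differentiable[OF w] by (auto simp: A_def B_def has_derivative_frechet)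
  note cnj_deriv = bounded_linear.has_derivative[OF bounded_linear_cnj]
  have Z: "((\<lambda>z. spinor_Z (\<psi> z) $ 1) has_derivative (\<lambda>h. \<i> * (cnj b * cnj (B h) + a * A h))) (at w)"
    "((\<lambda>z. spinor_Z (\<psi> z) $ 2) has_derivative (\<lambda>h. cnj b * cnj (B h) - a * A h)) (at w)"
    "((\<lambda>z. spinor_Z (\<psi> z) $ 3) has_derivative (\<lambda>h. A h * cnj b + a * cnj (B h))) (at w)"
    unfolding spinor_Z_nth a_def b_def
    by (auto intro!: derivative_eq_intros cnj_deriv A B simp: algebra_simps)
  have D: "((\<lambda>z. \<xi> i z) has_derivative (\<lambda>h. su2_comb
      (coord_dir i * (\<i> * (cnj b * cnj (B h) + a * A h))
        + cnj (coord_dir i) * cnj (\<i> * (cnj b * cnj (B h) + a * A h)))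
      (coord_dir i * (cnj b * cnj (B h) - a * A h)
        + cnj (coord_dir i) * cnj (cnj b * cnj (B h) - a * A h))
      (coord_dir i * (A h * cnj b + a * cnj (B h))
        + cnj (coord_dir i) * cnj (A h * cnj b + a * cnj (B h))))) (at w)" for i
    unfolding \<xi>_su2_comb
    by (intro has_derivative_su2_comb has_derivative_add has_derivative_mult_right cnj_deriv Z)
  have pq: "p = (A 1 + \<i> * A \<i>) / 2" "q = (cnj (B 1) + \<i> * cnj (B \<i>)) / 2"
    by (simp_all add: p_def q_def delbar_def del_def pd_def A_def B_def)
  show "pd 1 (\<xi> 2) w - pd 2 (\<xi> 1) w =
           su2_comb (2 * \<i> * (d1 - cnj d1)) (2 * \<i> * (d2 - cnj d2)) (2 * \<i> * (d3 - cnj d3))"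
    and "pd 1 (\<xi> 1) w + pd 2 (\<xi> 2) w =
           su2_comb (2 * (d1 + cnj d1)) (2 * (d2 + cnj d2)) (2 * (d3 + cnj d3))"
    unfolding pd_eqI[OF D] d1_def d2_def d3_def pq su2_comb_arith su2_comb_eq_iff
    by (simp_all add: field_simps)
qed

text \<open>The Dirac equation up to the meaning of \<open>Re x\<close>: the curl of
  \<open>\<xi>\<close> fixes \<open>Im x\<close>, while the divergence, later identified with the
  tension field, carries \<open>Re x\<close>.\<close>

lemma dirac_structure:
  assumes w: "w \<in> U"
  shows "\<exists>x. delbar (\<lambda>z. \<psi> z $ 1) w = x * \<psi> w $ 2 \<and> del (\<lambda>z. \<psi> z $ 2) w = - cnj x * \<psi> w $ 1 \<and>
           Im x = spinor_density (\<psi> w) / 2 \<and>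
           pd 1 (\<xi> 1) w + pd 2 (\<xi> 2) w = (4 * Re x) *\<^sub>R spinor_normal (\<psi> w)"
proof -
  define a b where "a = \<psi> w $ 1" and "b = \<psi> w $ 2"
  define p q where "p = delbar (\<lambda>z. \<psi> z $ 1) w" and "q = cnj (del (\<lambda>z. \<psi> z $ 2) w)"
  define r where "r = complex_of_real (spinor_density (\<psi> w))"
  define d1 d2 d3 where "d1 = \<i> * (cnj b * q + a * p)" and "d2 = cnj b * q - a * p"
    and "d3 = p * cnj b + a * q"
  note d_defs = d1_def d2_def d3_def
  note der = \<xi>_derivatives[OF w, folded a_def b_def p_def q_def, folded d_defs]
  have "pd 1 (\<xi> 2) w - pd 2 (\<xi> 1) w + commutator (\<xi> 1 w) (\<xi> 2 w) = 0"
    by (rule maurer_cartan[OF U w C2]) (auto simp: f_SU2 pd_f \<xi>_differentiable w)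
  then have "pd 1 (\<xi> 2) w - pd 2 (\<xi> 1) w = - commutator (\<xi> 1 w) (\<xi> 2 w)"
    by (simp add: eq_neg_iff_add_eq_0)
  also have "\<dots> = cscale (- 2 * r) (spinor_normal (\<psi> w))"
    by (simp add: \<xi>_commutator r_def vec_eq_iff)
  finally have mc: "2 * \<i> * (d1 - cnj d1) = - 2 * r * (\<i> * (a * b - cnj a * cnj b))"
    "2 * \<i> * (d2 - cnj d2) = - 2 * r * (- (a * b + cnj a * cnj b))"
    "2 * \<i> * (d3 - cnj d3) = - 2 * r * (b * cnj b - a * cnj a)"
    unfolding der spinor_normal_def su2_comb_arith su2_comb_eq_iff a_def b_def by blast+
  \<comment> \<open>This combination of the first two coordinates eliminates \<open>a * b\<close>
    and leaves only \<open>cnj a * cnj b\<close>.\<close>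
  have "cnj b * q + cnj a * cnj p
      = - 1/4 * (2 * \<i> * (d1 - cnj d1)) - \<i>/4 * (2 * \<i> * (d2 - cnj d2))"
    by (simp add: d_defs algebra_simps)
  also have "\<dots> = - \<i> * r * (cnj a * cnj b)"
    unfolding mc by (simp add: field_simps)
  finally have E1: "cnj b * q + cnj a * cnj p = - \<i> * r * (cnj a * cnj b)" .
  have "cnj b * p + a * q - (b * cnj p + cnj a * cnj q) = - \<i>/2 * (2 * \<i> * (d3 - cnj d3))"
    by (simp add: d_defs algebra_simps)
  also have "\<dots> = \<i> * r * (b * cnj b - a * cnj a)"
    unfolding mc by simp
  finally have E2: "cnj b * p + a * q - (b * cnj p + cnj a * cnj q) = \<i> * r * (b * cnj b - a * cnj a)" .
  have r: "r = of_real ((cmod a)\<^sup>2 + (cmod b)\<^sup>2)"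
    by (simp add: r_def spinor_density_def a_def b_def)
  obtain x where x: "p = x * b" "q = - x * cnj a" "Im x = spinor_density (\<psi> w) / 2"
    using spinor_structure_equations[OF _ E1[unfolded r] E2[unfolded r]] \<psi>_nonzero[OF w]
    unfolding spinor_density_def a_def b_def by blast
  have "x + cnj x = of_real (2 * Re x)" by (simp add: complex_eq_iff)
  \<comment> \<open>Now \<open>delbar Psi\<close> is \<open>x\<close> times
    \<open>spinor_normal\<close>, whose coordinates are real, so adding the conjugate only replaces
    \<open>x\<close> by \<open>x + cnj x\<close>.\<close>
  moreover have "2 * (d1 + cnj d1) = 2 * (x + cnj x) * (\<i> * (a * b - cnj a * cnj b))"
    "2 * (d2 + cnj d2) = 2 * (x + cnj x) * (- (a * b + cnj a * cnj b))"
    "2 * (d3 + cnj d3) = 2 * (x + cnj x) * (b * cnj b - a * cnj a)"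
    unfolding d_defs x(1,2) by (simp_all add: algebra_simps)
  ultimately have "pd 1 (\<xi> 1) w + pd 2 (\<xi> 2) w = (4 * Re x) *\<^sub>R spinor_normal (\<psi> w)"
    unfolding der scaleR_eq_cscale spinor_normal_def su2_comb_arith a_def b_def by simp
  moreover have "del (\<lambda>z. \<psi> z $ 2) w = cnj q" by (simp add: q_def)
  ultimately show ?thesis
    using x unfolding p_def a_def b_def by (intro exI[of _ x]) simp
qed

section \<open>Tension field, unit normal and mean curvature\<close>

lemma metric_coeff_f:
  "w \<in> U \<Longrightarrow> metric_coeff f w $ i $ j = (if i = j then exp (2 * \<alpha> w) else 0)"
proof -
  have "\<forall>i j. Re (coord_dir i * cnj (coord_dir j)) = (if i = j then 1 else 0)"
    by (simp add: forall_2)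
  then show "w \<in> U \<Longrightarrow> ?thesis"
    using conf by (simp add: metric_coeff_def conformal_parameter_def)
qed

lemma inverse_metric_coeff_f:
  assumes w: "w \<in> U"
  shows "matrix_inv (metric_coeff f w) $ i $ j = (if i = j then exp (- 2 * \<alpha> w) else 0)"
proof -
  have "matrix_inv (metric_coeff f w) = (\<chi> i j. if i = j then exp (- 2 * \<alpha> w) else 0)"
    by (rule matrix_inv_eqI)
      (simp_all add: vec_eq_iff forall_2 matrix_matrix_mult_def sum_2 metric_coeff_f[OF w] mat_def
        flip: exp_add)
  then show ?thesis by simp
qed

text \<open>With metric \<open>E (dx^2 + dy^2)\<close> the trace of the bracket is
  \<open>2 pd l E - 2 pd l E\<close>, the second 2 being the dimension.\<close>

lemma sum_christoffel:
  assumes w: "w \<in> U"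
  shows "christoffel f w k 1 1 + christoffel f w k 2 2 = 0"
proof -
  have pd: "pd l (\<lambda>z. metric_coeff f z $ i $ j) w = (if i = j then pd l (\<lambda>z. exp (2 * \<alpha> z)) w else 0)"
    for i j l
  proof -
    have "pd l (\<lambda>z. metric_coeff f z $ i $ j) w = pd l (\<lambda>z. if i = j then exp (2 * \<alpha> z) else 0) w"
      by (rule pd_cong_open[OF U w metric_coeff_f])
    also have "\<dots> = (if i = j then pd l (\<lambda>z. exp (2 * \<alpha> z)) w else 0)"
      by (simp add: pd_eqI[OF has_derivative_const])
    finally show ?thesis .
  qed
  have "\<forall>k. christoffel f w k 1 1 + christoffel f w k 2 2 = 0"
    by (simp add: forall_2 christoffel_def sum_2 pd inverse_metric_coeff_f[OF w])
  then show ?thesis ..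
qed

text \<open>The inverse metric is diagonal, the connection term
  \<open>[\<xi> i, \<xi> i] / 2\<close> vanishes and the Christoffel symbols cancel in the trace,
  which leaves the divergence of \<open>\<xi>\<close>.\<close>

lemma tension_f:
  assumes w: "w \<in> U"
  shows "tension f w = exp (- 2 * \<alpha> w) *\<^sub>R (f w ** (pd 1 (\<xi> 1) w + pd 2 (\<xi> 2) w))"
proof -
  have cov: "cov_deriv f i (pd i f) w = f w ** pd i (\<xi> i) w" for i
  proof -
    have "pd i (\<lambda>z. matrix_inv (f z) ** pd i f z) w = pd i (\<xi> i) w"
      by (rule pd_cong_open[OF U w]) (simp add: \<xi>_eq)
    then show ?thesis by (simp add: cov_deriv_def su2_nabla_def commutator_def)
  qed
  have "second_fund f w 1 1 + second_fund f w 2 2 = f w ** pd 1 (\<xi> 1) w + f w ** pd 2 (\<xi> 2) w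
      - (\<Sum>k\<in>UNIV. (christoffel f w k 1 1 + christoffel f w k 2 2) *\<^sub>R pd k f w)"
    unfolding second_fund_def cov by (simp add: scaleR_left_distrib sum.distrib)
  then have "second_fund f w 1 1 + second_fund f w 2 2 = f w ** (pd 1 (\<xi> 1) w + pd 2 (\<xi> 2) w)"
    by (simp add: sum_christoffel[OF w] matrix_add_ldistrib)
  moreover have "tension f w = exp (- 2 * \<alpha> w) *\<^sub>R (second_fund f w 1 1 + second_fund f w 2 2)"
    by (simp add: tension_def sum_2 inverse_metric_coeff_f[OF w] scaleR_right_distrib)
  ultimately show ?thesis by simp
qed

lemma mat_del_f:
  assumes w: "w \<in> U"
  shows "mat_del f w = f w ** Psi (\<psi> w)" "mat_delbar f w = f w ** Psi_star (\<psi> w)"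
proof -
  have "\<xi> 1 w - cscale \<i> (\<xi> 2 w) = cscale 2 (Psi (\<psi> w))"
    "\<xi> 1 w + cscale \<i> (\<xi> 2 w) = cscale 2 (Psi_star (\<psi> w))"
    by (simp_all add: \<xi>_def vec_eq_iff algebra_simps)
  then have *: "f w ** (\<xi> 1 w - cscale \<i> (\<xi> 2 w)) = cscale 2 (f w ** Psi (\<psi> w))"
    "f w ** (\<xi> 1 w + cscale \<i> (\<xi> 2 w)) = cscale 2 (f w ** Psi_star (\<psi> w))"
    by (simp_all add: cscale_arith)
  have "mat_del f w = cscale (1/2) (f w ** (\<xi> 1 w - cscale \<i> (\<xi> 2 w)))"
    "mat_delbar f w = cscale (1/2) (f w ** (\<xi> 1 w + cscale \<i> (\<xi> 2 w)))"
    by (simp_all add: vec_eq_iff mat_del_def mat_delbar_def del_def delbar_def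
        pd_nth[OF Ck_on_2D(1)[OF C2 w]] pd_f[OF w] bounded_bilinear.diff_right[OF bounded_bilinear_matrix_mult]
        matrix_add_ldistrib cscale_arith)
  then show "mat_del f w = f w ** Psi (\<psi> w)" "mat_delbar f w = f w ** Psi_star (\<psi> w)"
    unfolding * by (simp_all add: cscale_arith)
qed

text \<open>By \<open>commutator_Psi\<close> the scalar factor is
  \<open>(- \<i> / r^2) (\<i> r) = 1 / r\<close>, where \<open>r\<close> is the density and
  \<open>e^(2 \<alpha>) = r^2\<close>.\<close>

lemma unit_normal_f:
  assumes w: "w \<in> U"
  shows "unit_normal \<alpha> f w = f w ** (inverse (spinor_density (\<psi> w)) *\<^sub>R spinor_normal (\<psi> w))"
proof -
  let ?r = "spinor_density (\<psi> w)"
  have "exp (- 2 * \<alpha> w) * ?r = inverse ?r"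
    using exp_\<alpha>[OF w] spinor_density_pos[OF w] by (simp add: exp_minus power2_eq_square)
  then have "of_real (exp (- 2 * \<alpha> w)) * of_real ?r = complex_of_real (inverse ?r)"
    by (metis of_real_mult)
  then have "(- \<i> * of_real (exp (- 2 * \<alpha> w))) * (\<i> * of_real ?r) = complex_of_real (inverse ?r)"
    by (simp add: mult.assoc mult.left_commute)
  then show ?thesis
    by (simp add: unit_normal_def mat_del_f[OF w] SU2_cancel f_SU2[OF w] commutator_Psi
        scaleR_eq_cscale cscale_arith(1) del: of_real_inverse)
qed

text \<open>Makes the coefficient of the normal unique, as the definite description in
  \<open>mean_curvature\<close> requires.\<close>

lemma unit_normal_nonzero:
  assumes w: "w \<in> U" shows "unit_normal \<alpha> f w \<noteq> 0"
proof
  assume "unit_normal \<alpha> f w = 0"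
  then have "f w ** (inverse (spinor_density (\<psi> w)) *\<^sub>R spinor_normal (\<psi> w)) = f w ** 0"
    by (simp add: unit_normal_f[OF w])
  then have "spinor_normal (\<psi> w) = 0"
    using spinor_density_pos[OF w] by (simp only: SU2_cancel(2)[OF f_SU2[OF w]]) simp
  then show False
    using \<psi>_nonzero[OF w] by (auto simp: spinor_normal_eq_0_iff)
qed

text \<open>Compares the tension, \<open>4 c / r^2\<close> times the translated
  \<open>spinor_normal\<close>, with \<open>2 H\<close> times the normal, \<open>2 H / r\<close>
  times the same vector.\<close>

lemma mean_curvature_f:
  assumes w: "w \<in> U"
    and lap: "pd 1 (\<xi> 1) w + pd 2 (\<xi> 2) w = (4 * c) *\<^sub>R spinor_normal (\<psi> w)"
  shows "mean_curvature \<alpha> f w * spinor_density (\<psi> w) = 2 * c"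
proof -
  let ?r = "spinor_density (\<psi> w)"
  have r: "?r > 0" by (rule spinor_density_pos[OF w])
  have e: "exp (- 2 * \<alpha> w) = inverse (?r * ?r)"
    using exp_\<alpha>[OF w] by (simp add: exp_minus power2_eq_square)
  note scale = bounded_bilinear.scaleR_right[OF bounded_bilinear_matrix_mult]
  have t: "tension f w = (2 * (2 * c / ?r)) *\<^sub>R unit_normal \<alpha> f w"
    using r unfolding tension_f[OF w] unit_normal_f[OF w] lap e scale
    by (simp add: field_simps)
  have "mean_curvature \<alpha> f w = 2 * c / ?r"
    unfolding mean_curvature_def
  proof (rule the_equality, rule t)
    fix H assume "tension f w = (2 * H) *\<^sub>R unit_normal \<alpha> f w"
    with t have "2 * H = 2 * (2 * c / ?r)"
      using unit_normal_nonzero[OF w] by (metis scaleR_cancel_right)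
    then show "H = 2 * c / ?r" by simp
  qed
  then show ?thesis using r by simp
qed

lemma dirac_equation:
  assumes w: "w \<in> U"
  shows "dirac_op (potential (mean_curvature \<alpha> f) \<psi>) \<psi> w = 0"
proof -
  obtain x where x: "delbar (\<lambda>z. \<psi> z $ 1) w = x * \<psi> w $ 2" "del (\<lambda>z. \<psi> z $ 2) w = - cnj x * \<psi> w $ 1"
    "Im x = spinor_density (\<psi> w) / 2"
    "pd 1 (\<xi> 1) w + pd 2 (\<xi> 2) w = (4 * Re x) *\<^sub>R spinor_normal (\<psi> w)"
    using dirac_structure[OF w] by blast
  have "potential (mean_curvature \<alpha> f) \<psi> w =
      1/2 * (of_real (mean_curvature \<alpha> f w) - \<i>) * of_real (spinor_density (\<psi> w))"
    by (simp add: potential_def spinor_density_def)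
  \<comment> \<open>The real part comes from the mean curvature, the imaginary part from the
    Maurer-Cartan equation.\<close>
  also have "\<dots> = cnj x"
    using mean_curvature_f[OF w x(4)] x(3) by (simp add: complex_eq_iff)
  finally have V: "potential (mean_curvature \<alpha> f) \<psi> w = cnj x" .
  show ?thesis
    by (simp add: dirac_op_def V x(1,2) vec_eq_iff forall_2 matrix_vector_mult_def sum_2)
qed

end

theorem theorem8:
  fixes U :: "complex set" and f :: "complex \<Rightarrow> complex^2^2"
    and \<alpha> :: "complex \<Rightarrow> real" and \<psi> :: "complex \<Rightarrow> complex^2"
  assumes "open U"
    and "immersion_on U f"
    and "conformal_parameter U f \<alpha>"
    and "spinor_field U f \<psi>"
  shows "\<forall>z\<in>U. \<psi> differentiable (at z) \<and>
           dirac_op (potential (mean_curvature \<alpha> f) \<psi>) \<psi> z = 0"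
proof -
  interpret conformal_spinor_surface U f \<alpha> \<psi>
    using assms by unfold_locales
  show ?thesis using \<psi>_differentiable dirac_equation by blast
qed

end
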